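(* Let $\lambda=(\mu_1,\mu_2)$ be a neighborly partition. Then $\operatorname{signature}(G_\lambda)=0$ if and only if the multiset $SIG(G_\lambda)$ contains an element $x\equiv 0\pmod 3$. Otherwise $$ \operatorname{signature}(G_\lambda)=(-1)^{t+s}, $$ where $t$ is the number of elements (counted with multiplicity) $x\in SIG(G_\lambda)$ with $x\equiv 1\pmod 3$, and $s$ is the number of parts of $\mu_2$.
   Context: Partitions are written with parts in increasing order. A partition $\lambda$ is neighborly if every value occurs as a part at most twice and for every part $\lambda_i$ there is a part $\lambda_j$ with $j\ne i$ and $|\lambda_i-\lambda_j|\le 1$. Write $\lambda=(\mu_1,\mu_2)$ where $\mu_1$ is the set of distinct part values and $\mu_2\subseteq\mu_1$ the set of values occurring twice. The graph $G_\lambda$ has one vertex $v$ for each $v\in\mu_1$ and one additional vertex $v'$ for each $v\in\mu_2$; its edges are the backbone edges $\{v,v+1\}$ whenever $v,v+1\in\mu_1$, and the hanging edges $\{v,v'\}$ for $v\in\mu_2$. For a finite graph $G$, a vertex spanning forest is a set $H$ of edges such that every vertex is incident to some edge of $H$, and $\operatorname{signature}(G)=\sum_H(-1)^{|H|}$ over all vertex spanning forests $H$. Signature multiset: each connected component $c$ of $G_\lambda$ has backbone vertices forming a maximal run $\{k,k+1,\dots,n\}$ of consecutive integers in $\mu_1$; let $a_1<\dots<a_s$ be the elements of $\mu_2$ in this run. If $s\ge1$, $SIG(c)$ is the multiset $\{a_1-k+1,\ a_2-a_1+2,\ \dots,\ a_s-a_{s-1}+2,\ n-a_s+1\}$; if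 $s=0$ (then $n>k$), $SIG(c)=\{n-k\}$. $SIG(G_\lambda)$ is the multiset union of $SIG(c)$ over all connected components $c$. *)

theory Defs
  imports Main "HOL-Library.Multiset"
begin

definition is_partition :: "nat list \<Rightarrow> bool" where
  "is_partition p \<longleftrightarrow> sorted p \<and> (\<forall>x\<in>set p. 0 < x)"

definition neighborly :: "nat list \<Rightarrow> bool" where
  "neighborly p \<longleftrightarrow>
     (\<forall>v. count_list p v \<le> 2) \<and>
     (\<forall>i<length p. \<exists>j<length p. j \<noteq> i \<and> \<bar>int (p ! i) - int (p ! j)\<bar> \<le> 1)"

definition mu1 :: "nat list \<Rightarrow> nat set" where
  "mu1 p = set p"

definition mu2 :: "nat list \<Rightarrow> nat set" where
  "mu2 p = {v. count_list p v = 2}"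

text \<open>A graph is a pair of a vertex set and a set of edges, each edge being a two-element set of
  vertices.\<close>

type_synonym 'a ugraph = "'a set \<times> 'a set set"

text \<open>No acyclicity is required: the graphs considered below are themselves forests, so every set
  of their edges is one.\<close>

definition vertex_spanning_forests :: "'a ugraph \<Rightarrow> 'a set set set" where
  "vertex_spanning_forests G = {H. H \<subseteq> snd G \<and> (\<forall>v\<in>fst G. \<exists>e\<in>H. v \<in> e)}"

definition signature :: "'a ugraph \<Rightarrow> int" where
  "signature G = (\<Sum>H\<in>vertex_spanning_forests G. (-1) ^ card H)"

definition connected_components :: "'a ugraph \<Rightarrow> 'a set set" where
  "connected_components G =
     fst G // {(u, v). u \<in> fst G \<and> v \<in> fst G \<and> (u, v) \<in> {(x, y). {x, y} \<in> snd G}\<^sup>*}"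

text \<open>\<open>Hanging v\<close> is the additional vertex \<open>v'\<close> attached to a repeated value \<open>v\<close>.\<close>

datatype vertex = Backbone nat | Hanging nat

definition partition_graph :: "nat list \<Rightarrow> vertex ugraph" where
  "partition_graph p =
     (Backbone ` mu1 p \<union> Hanging ` mu2 p,
      {{Backbone v, Backbone (v + 1)} | v. v \<in> mu1 p \<and> v + 1 \<in> mu1 p} \<union>
      {{Backbone v, Hanging v} | v. v \<in> mu2 p})"

text \<open>The subtractions on natural numbers never truncate here, as
  \<open>k \<le> a\<^sub>1 < \<dots> < a\<^sub>s \<le> n\<close>. Zipping \<open>as\<close> with its tail yields the pairs of consecutive entries.\<close>

definition SIG_component :: "nat list \<Rightarrow> vertex set \<Rightarrow> nat multiset" where
  "SIG_component p c =
     (let B = {v. Backbone v \<in> c};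
          k = Min B;
          n = Max B;
          as = sorted_list_of_set (B \<inter> mu2 p)
      in if as = [] then {#n - k#}
         else {#hd as - k + 1#}
              + mset (map (\<lambda>(a, b). b - a + 2) (zip as (tl as)))
              + {#n - last as + 1#})"

definition SIG :: "nat list \<Rightarrow> nat multiset" where
  "SIG p = (\<Sum>c\<in>connected_components (partition_graph p). SIG_component p c)"

end

theory Submission imports Defs begin

text \<open>The signature is multiplicative over connected components. The component on the run
  \<open>{k..n}\<close> must contain all its hanging edges, which contributes a sign for each of them and covers
  the vertices \<open>a\<^sub>1, \<dots>, a\<^sub>s\<close> for free; the backbone therefore falls apart into independent paths cut
  at the \<open>a\<^sub>i\<close>. A path with one or two covered ends has, up to sign, the signature of the path
  with a forced pendant edge added at each covered end, so the lengths of these extended paths are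
  the elements of \<open>SIG\<close>. The signature of a path with \<open>m\<close> edges is 0, -1, 1 for \<open>m\<close> congruent to
  0, 1, 2 modulo 3. The two outer paths each carry one additional minus sign, and these cancel.\<close>

section \<open>Signed edge covers: deletion, forced edges, products\<close>

text \<open>The vertices to be covered are kept separate from the edges, so that the recursion stays
  inside this class: once an edge has been chosen, its ends may still lie on other edges but need no
  further cover.\<close>

definition cover_sum :: "'a set set \<Rightarrow> 'a set \<Rightarrow> int" where
  "cover_sum E W = (\<Sum>H | H \<subseteq> E \<and> W \<subseteq> \<Union>H. (-1) ^ card H)"

lemma signature_eq_cover_sum: "signature G = cover_sum (snd G) (fst G)"
  unfolding signature_def vertex_spanning_forests_def cover_sum_def
  by (rule sum.cong) auto

lemma cover_sum_empty [simp]: "cover_sum {} W = (if W = {} then 1 else 0)"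
proof -
  have "{H. H \<subseteq> {} \<and> W \<subseteq> \<Union>H} = (if W = {} then {{}} else {})" by auto
  then show ?thesis by (simp add: cover_sum_def)
qed

lemma cover_sum_uncoverable: "w \<in> W \<Longrightarrow> w \<notin> \<Union>E \<Longrightarrow> cover_sum E W = 0"
  unfolding cover_sum_def by (rule sum.neutral) blast

text \<open>Deletion recursion: a cover that uses \<open>e\<close> corresponds to a subset of
  \<open>E\<close> covering what \<open>e\<close> misses, and dropping \<open>e\<close> flips the
  sign.\<close>

lemma cover_sum_insert:
  assumes "finite E" "e \<notin> E"
  shows "cover_sum (insert e E) W = cover_sum E W - cover_sum E (W - e)"
proof -
  let ?A = "{H. H \<subseteq> E \<and> W \<subseteq> \<Union>H}" and ?B = "{H. H \<subseteq> E \<and> W - e \<subseteq> \<Union>H}"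
  have "{H. H \<subseteq> insert e E \<and> W \<subseteq> \<Union>H} = ?A \<union> insert e ` ?B" (is "?L = ?R")
  proof (intro equalityI subsetI)
    fix H assume H: "H \<in> ?L"
    show "H \<in> ?R"
    proof (cases "e \<in> H")
      case True
      then have "H = insert e (H - {e})" "H - {e} \<in> ?B" using H by auto
      then show ?thesis by blast
    next
      case False
      then show ?thesis using H by blast
    qed
  qed auto
  moreover have "?A \<inter> insert e ` ?B = {}" using assms by auto
  moreover have "finite ?A" "finite ?B" using assms by auto
  moreover have "inj_on (insert e) ?B"
    using assms by (intro inj_onI) (metis (mono_tags, lifting) insert_ident mem_Collect_eq subsetD)
  ultimately have "cover_sum (insert e E) W = cover_sum E W + (\<Sum>H\<in>?B. (-1) ^ card (insert e H))"
    by (simp add: cover_sum_def sum.union_disjoint sum.reindex)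
  also have "(\<Sum>H\<in>?B. (-1) ^ card (insert e H)) = (\<Sum>H\<in>?B. - ((-1) ^ card H :: int))"
  proof (rule sum.cong[OF refl])
    fix H assume "H \<in> ?B"
    then have "finite H" "e \<notin> H" using assms finite_subset by auto
    then show "(-1) ^ card (insert e H) = - ((-1) ^ card H :: int)" by simp
  qed
  finally show ?thesis by (simp add: cover_sum_def sum_negf)
qed

text \<open>Only \<open>e\<close> reaches \<open>w\<close>, so the covers that avoid
  \<open>e\<close> do not exist and one term of the deletion recursion vanishes.\<close>

lemma cover_sum_insert_forced:
  assumes "finite E" "w \<in> W" "w \<in> e" "w \<notin> \<Union>E"
  shows "cover_sum (insert e E) W = - cover_sum E (W - e)"
  using assms cover_sum_insert[of E e W] cover_sum_uncoverable[of w W E] by auto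

text \<open>Each cover splits uniquely into its parts in \<open>E\<close> and \<open>F\<close>.
  Edges of \<open>E\<close> and \<open>F\<close> may meet, provided that they do so outside
  \<open>V\<close> and \<open>W\<close>; this is what later permits cutting a path at a vertex that
  is already covered.\<close>

lemma cover_sum_Un:
  assumes fin: "finite E" "finite F"
    and disj: "E \<inter> F = {}" "V \<inter> \<Union>F = {}" "W \<inter> \<Union>E = {}"
  shows "cover_sum (E \<union> F) (V \<union> W) = cover_sum E V * cover_sum F W"
proof -
  let ?A = "{H. H \<subseteq> E \<and> V \<subseteq> \<Union>H}" and ?B = "{H. H \<subseteq> F \<and> W \<subseteq> \<Union>H}"
  have "cover_sum E V * cover_sum F W = (\<Sum>(H, K)\<in>?A \<times> ?B. (-1) ^ card H * (-1) ^ card K)"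
    by (simp add: cover_sum_def sum_product sum.cartesian_product)
  also have "\<dots> = (\<Sum>H | H \<subseteq> E \<union> F \<and> V \<union> W \<subseteq> \<Union>H. (-1) ^ card H)"
  proof (rule sum.reindex_bij_witness[of _ "\<lambda>H. (H \<inter> E, H \<inter> F)" "\<lambda>(H, K). H \<union> K"])
    fix x assume "x \<in> ?A \<times> ?B"
    then obtain H K where x: "x = (H, K)" "H \<subseteq> E" "V \<subseteq> \<Union>H" "K \<subseteq> F" "W \<subseteq> \<Union>K" by auto
    show "(case x of (H, K) \<Rightarrow> H \<union> K) \<in> {H. H \<subseteq> E \<union> F \<and> V \<union> W \<subseteq> \<Union>H}" using x by auto
    show "((case x of (H, K) \<Rightarrow> H \<union> K) \<inter> E, (case x of (H, K) \<Rightarrow> H \<union> K) \<inter> F) = x"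
      using x disj by auto
    have "finite H" "finite K" "H \<inter> K = {}" using x fin disj finite_subset by auto
    then show "(-1) ^ card (case x of (H, K) \<Rightarrow> H \<union> K) =
        (case x of (H, K) \<Rightarrow> (-1) ^ card H * (-1 :: int) ^ card K)"
      by (simp add: x card_Un_disjoint power_add)
  next
    fix H assume H: "H \<in> {H. H \<subseteq> E \<union> F \<and> V \<union> W \<subseteq> \<Union>H}"
    then show "(case (H \<inter> E, H \<inter> F) of (H, K) \<Rightarrow> H \<union> K) = H" by auto
    \<comment> \<open>No edge of \<open>F\<close> meets \<open>V\<close>, so the edge of
      \<open>H\<close> that covers a vertex of \<open>V\<close> must come from
      \<open>E\<close>.\<close>
    have "V \<subseteq> \<Union>(H \<inter> E)"
    proof
      fix v assume "v \<in> V"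
      moreover from this obtain e where "e \<in> H" "v \<in> e" using H by blast
      ultimately show "v \<in> \<Union>(H \<inter> E)" using H disj by blast
    qed
    moreover have "W \<subseteq> \<Union>(H \<inter> F)"
    proof
      fix v assume "v \<in> W"
      moreover from this obtain e where "e \<in> H" "v \<in> e" using H by blast
      ultimately show "v \<in> \<Union>(H \<inter> F)" using H disj by blast
    qed
    ultimately show "(H \<inter> E, H \<inter> F) \<in> ?A \<times> ?B" by auto
  qed
  finally show ?thesis by (simp add: cover_sum_def)
qed

lemma cover_sum_disjoint_family:
  assumes "finite C" "pairwise disjnt C" "\<And>c. c \<in> C \<Longrightarrow> finite (A c)"
    "\<And>c e. c \<in> C \<Longrightarrow> e \<in> A c \<Longrightarrow> e \<noteq> {} \<and> e \<subseteq> c"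
  shows "cover_sum (\<Union>c\<in>C. A c) (\<Union>C) = (\<Prod>c\<in>C. cover_sum (A c) c)"
  using assms
proof (induction C)
  case empty
  then show ?case by simp
next
  case (insert c C)
  have *: "c \<inter> d = {}" if "d \<in> C" for d
    using insert.prems(1) insert.hyps that by (auto simp: pairwise_insert disjnt_def)
  have A: "e \<noteq> {} \<and> e \<subseteq> d" if "e \<in> A d" "d \<in> insert c C" for e d
    using insert.prems that by blast
  have "cover_sum (A c \<union> (\<Union>c\<in>C. A c)) (c \<union> \<Union>C) = cover_sum (A c) c * cover_sum (\<Union>c\<in>C. A c) (\<Union>C)"
  proof (rule cover_sum_Un)
    \<comment> \<open>A shared edge would lie in two disjoint vertex sets and so be empty, which is
      excluded.\<close>
    show "A c \<inter> (\<Union>c\<in>C. A c) = {}"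
    proof (rule ccontr)
      assume "A c \<inter> (\<Union>c\<in>C. A c) \<noteq> {}"
      then obtain e d where "e \<in> A c" "e \<in> A d" "d \<in> C" by blast
      then have "e \<noteq> {}" "e \<subseteq> c \<inter> d" using A[of e c] A[of e d] by auto
      then show False using *[OF \<open>d \<in> C\<close>] by auto
    qed
    show "c \<inter> \<Union>(\<Union>c\<in>C. A c) = {}" using A * by blast
    show "\<Union>C \<inter> \<Union>(A c) = {}" using A * by blast
  qed (use insert in auto)
  moreover have "cover_sum (\<Union>c\<in>C. A c) (\<Union>C) = (\<Prod>c\<in>C. cover_sum (A c) c)"
    using insert by (intro insert.IH) (auto simp: pairwise_insert)
  ultimately show ?case using insert.hyps by simp
qed

section \<open>Connected components and multiplicativity of the signature\<close>

text \<open>Names the relation inside \<open>connected_components\<close>, so that the general facts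
  on quotients by an equivalence apply.\<close>

definition adj_closure :: "'a ugraph \<Rightarrow> ('a \<times> 'a) set" where
  "adj_closure G = {(u, v). u \<in> fst G \<and> v \<in> fst G \<and> (u, v) \<in> {(x, y). {x, y} \<in> snd G}\<^sup>*}"

lemma connected_components_eq: "connected_components G = fst G // adj_closure G"
  by (simp add: connected_components_def adj_closure_def)

lemma equiv_adj_closure: "equiv (fst G) (adj_closure G)"
proof (rule equivI)
  have "sym {(x, y). {x, y} \<in> snd G}" by (auto intro!: symI simp: insert_commute)
  then have "sym ({(x, y). {x, y} \<in> snd G}\<^sup>*)" by (rule sym_rtrancl)
  then show "sym (adj_closure G)" unfolding adj_closure_def by (auto intro!: symI dest: symD)
  show "trans (adj_closure G)" unfolding adj_closure_def by (auto intro!: transI)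
qed (auto simp: adj_closure_def refl_on_def)

lemma Union_connected_components: "\<Union>(connected_components G) = fst G"
  unfolding connected_components_eq by (rule Union_quotient[OF equiv_adj_closure])

lemma connected_component_closed:
  assumes "c \<in> connected_components G" "x \<in> c" "{x, y} \<in> snd G" "y \<in> fst G"
  shows "y \<in> c"
proof -
  have "x \<in> fst G"
    using assms(1,2) Union_connected_components[of G] by blast
  then have "(x, y) \<in> adj_closure G" using assms by (auto simp: adj_closure_def)
  then show ?thesis
    using assms in_quotient_imp_closed[OF equiv_adj_closure] by (metis connected_components_eq)
qed

text \<open>The ends of an edge lie in the same component, so restricting the edges to the
  components loses none of them.\<close>

lemma signature_eq_prod_components:
  assumes "finite (fst G)" "finite (snd G)"
    and edges: "\<And>e. e \<in> snd G \<Longrightarrow> \<exists>x\<in>fst G. \<exists>y\<in>fst G. e = {x, y}"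
  shows "signature G = (\<Prod>c\<in>connected_components G. cover_sum {e\<in>snd G. e \<subseteq> c} c)"
proof -
  let ?C = "connected_components G"
  note V = Union_connected_components[of G]
  have E: "(\<Union>c\<in>?C. {e\<in>snd G. e \<subseteq> c}) = snd G"
  proof
    show "snd G \<subseteq> (\<Union>c\<in>?C. {e\<in>snd G. e \<subseteq> c})"
    proof
      fix e assume e: "e \<in> snd G"
      then obtain x y where xy: "x \<in> fst G" "y \<in> fst G" "e = {x, y}" using edges by blast
      then obtain c where "c \<in> ?C" "x \<in> c" using V by blast
      then show "e \<in> (\<Union>c\<in>?C. {e\<in>snd G. e \<subseteq> c})"
        using connected_component_closed[of c G x y] xy e by blast
    qed
  qed auto
  have "cover_sum (\<Union>c\<in>?C. {e\<in>snd G. e \<subseteq> c}) (\<Union>?C) = (\<Prod>c\<in>?C. cover_sum {e\<in>snd G. e \<subseteq> c} c)"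
  proof (rule cover_sum_disjoint_family)
    show "finite ?C"
      unfolding connected_components_eq using assms(1)
      by (rule finite_quotient) (auto simp: adj_closure_def)
    show "pairwise disjnt ?C"
      unfolding connected_components_eq
      using quotient_disj[OF equiv_adj_closure[of G]] unfolding pairwise_def disjnt_def by blast
  qed (use assms edges in auto)
  then show ?thesis by (simp add: V E signature_eq_cover_sum)
qed

section \<open>Paths with covered vertices\<close>

abbreviation path_edges :: "nat \<Rightarrow> nat \<Rightarrow> vertex set set" where
  "path_edges a b \<equiv> (\<lambda>v. {Backbone v, Backbone (Suc v)}) ` {a..<b}"

text \<open>This is the signature of a path with \<open>m\<close> edges.\<close>

definition s3 :: "nat \<Rightarrow> int" where
  "s3 m = (if m mod 3 = 0 then 0 else if m mod 3 = 1 then -1 else 1)"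

lemma s3_simps [simp]: "s3 0 = 0" "s3 (Suc 0) = -1" "s3 (Suc (Suc m)) = - s3 (Suc m) - s3 m"
proof -
  have "m mod 3 = 0 \<or> m mod 3 = 1 \<or> m mod 3 = 2" by linarith
  then show "s3 (Suc (Suc m)) = - s3 (Suc m) - s3 m" by (auto simp: s3_def mod_Suc)
qed (auto simp: s3_def)

text \<open>\<open>L\<close> records whether the left end has to be covered. If the right end
  \<open>Suc b\<close> has to be covered, the last edge is forced and covers \<open>b\<close> as
  well; if not, the last edge may be taken or left out. The two cases form a closed linear recursion
  in \<open>b\<close>.\<close>

lemma cover_sum_path_edges_Suc:
  assumes "a \<le> b" "L \<subseteq> {a}"
  shows "cover_sum (path_edges a (Suc b)) (Backbone ` (L \<union> {a<..Suc b})) =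
           - cover_sum (path_edges a b) (Backbone ` ((L \<union> {a<..b}) - {b}))"
    and "cover_sum (path_edges a (Suc b)) (Backbone ` ((L \<union> {a<..Suc b}) - {Suc b})) =
           cover_sum (path_edges a b) (Backbone ` (L \<union> {a<..b}))
         - cover_sum (path_edges a b) (Backbone ` ((L \<union> {a<..b}) - {b}))"
proof -
  let ?e = "{Backbone b, Backbone (Suc b)}"
  have E: "path_edges a (Suc b) = insert ?e (path_edges a b)"
    using assms by (auto simp: atLeastLessThanSuc)
  have notin: "Backbone (Suc b) \<notin> \<Union>(path_edges a b)" by auto
  then have e: "?e \<notin> path_edges a b" by blast
  have W: "Backbone ` (L \<union> {a<..Suc b}) - ?e = Backbone ` ((L \<union> {a<..b}) - {b})"
    using assms by (auto simp: le_Suc_eq)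
  show "cover_sum (path_edges a (Suc b)) (Backbone ` (L \<union> {a<..Suc b})) =
           - cover_sum (path_edges a b) (Backbone ` ((L \<union> {a<..b}) - {b}))"
    unfolding E W[symmetric]
    by (rule cover_sum_insert_forced[of _ "Backbone (Suc b)"]) (use assms notin in auto)
  have W2: "(L \<union> {a<..Suc b}) - {Suc b} = L \<union> {a<..b}"
    using assms by auto
  have W3: "Backbone ` (L \<union> {a<..b}) - ?e = Backbone ` ((L \<union> {a<..b}) - {b})"
    using assms by auto
  show "cover_sum (path_edges a (Suc b)) (Backbone ` ((L \<union> {a<..Suc b}) - {Suc b})) =
           cover_sum (path_edges a b) (Backbone ` (L \<union> {a<..b}))
         - cover_sum (path_edges a b) (Backbone ` ((L \<union> {a<..b}) - {b}))"
    unfolding E W2 W3[symmetric] by (rule cover_sum_insert) (use e in auto)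
qed

text \<open>The two values are proved together because the recursion turns each into the other; it
  then becomes the recurrence in \<open>s3_simps\<close>.\<close>

lemma cover_sum_path:
  "cover_sum (path_edges a (a + m)) (Backbone ` {a..a + m}) = s3 m \<and>
   cover_sum (path_edges a (a + m)) (Backbone ` {a..<a + m}) = - s3 (Suc m)"
proof -
  have eqs: "{a} \<union> {a<..b} = {a..b}" "{a..b} - {b} = {a..<b}" if "a \<le> b" for b using that by auto
  have eqs2: "{a} \<union> {a<..Suc b} - {Suc b} = {a..b}" if "a \<le> b" for b using that by auto
  show ?thesis
  proof (induction m)
    case (Suc m)
    then show ?case
      using cover_sum_path_edges_Suc[of a "a + m" "{a}"]
      \<comment> \<open>\<open>Un_insert_left\<close> would destroy the form
        \<open>{a} \<union> _\<close> that \<open>eqs\<close> and \<open>eqs2\<close>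
        rewrite.\<close>
      by (simp add: eqs eqs2 atLeastLessThanSuc_atLeastAtMost del: Un_insert_left)
  qed simp
qed

text \<open>The same recursion with other initial values: for \<open>m = 0\<close> nothing has to be
  covered, so both sums are 1.\<close>

lemma cover_sum_path_left_covered:
  "cover_sum (path_edges a (a + m)) (Backbone ` {a<..a + m}) = - s3 (Suc m) \<and>
   cover_sum (path_edges a (a + m)) (Backbone ` {a<..<a + m}) = s3 (Suc (Suc m))"
proof -
  have eqs: "{a<..b} - {b} = {a<..<b}" for b by auto
  show ?thesis
  proof (induction m)
    case (Suc m)
    then show ?case using cover_sum_path_edges_Suc[of a "a + m" "{}"] by (simp add: eqs)
  qed simp
qed

text \<open>The two halves share the vertex \<open>b\<close>, but \<open>b\<close> is in neither
  \<open>V\<close> nor \<open>W\<close>, so \<open>cover_sum_Un\<close> applies.\<close>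

lemma cover_sum_path_edges_split:
  assumes "a \<le> b" "b \<le> n" "V \<subseteq> {..<b}" "W \<subseteq> {b<..}"
  shows "cover_sum (path_edges a n) (Backbone ` (V \<union> W)) =
     cover_sum (path_edges a b) (Backbone ` V) * cover_sum (path_edges b n) (Backbone ` W)"
proof -
  have "{a..<n} = {a..<b} \<union> {b..<n}"
    using ivl_disj_un_two(3)[OF assms(1,2)] by simp
  then have "path_edges a n = path_edges a b \<union> path_edges b n"
    by (simp only: image_Un)
  moreover have "path_edges a b \<inter> path_edges b n = {}"
  proof -
    have "inj (\<lambda>v. {Backbone v, Backbone (Suc v)})"
      by (rule injI) (auto simp: doubleton_eq_iff)
    then show ?thesis by (simp flip: image_Int)
  qed
  moreover have "Backbone ` V \<inter> \<Union>(path_edges b n) = {}" "Backbone ` W \<inter> \<Union>(path_edges a b) = {}"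
  proof -
    have sub: "\<Union>(path_edges b n) \<subseteq> Backbone ` {b..}" "\<Union>(path_edges a b) \<subseteq> Backbone ` {..b}"
      by auto
    have "Backbone ` V \<inter> Backbone ` {b..} = {}" "Backbone ` W \<inter> Backbone ` {..b} = {}"
      using assms(3,4) by auto
    then show "Backbone ` V \<inter> \<Union>(path_edges b n) = {}" "Backbone ` W \<inter> \<Union>(path_edges a b) = {}"
      using Int_mono[OF subset_refl sub(1)] Int_mono[OF subset_refl sub(2)]
      by (metis subset_empty)+
  qed
  ultimately show ?thesis
    using cover_sum_Un[of "path_edges a b" "path_edges b n" "Backbone ` V" "Backbone ` W"]
    by (simp add: image_Un)
qed

text \<open>Cuts off one segment at a time. Segments between two covered vertices have sign +1; the
  single minus sign comes from the last segment, whose right end is not covered.\<close>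

lemma cover_sum_path_from_covered:
  assumes "sorted_wrt (<) (a # as)" "\<forall>x\<in>set (a # as). x \<le> n"
  shows "cover_sum (path_edges a n) (Backbone ` ({a..n} - set (a # as))) =
    - (\<Prod>(x, y)\<leftarrow>zip (a # as) as. s3 (y - x + 2)) * s3 (n - last (a # as) + 1)"
  using assms
proof (induction as arbitrary: a)
  case Nil
  have "{a..n} - {a} = {a<..n}" by auto
  then show ?case using cover_sum_path_left_covered[of a "n - a"] Nil by simp
next
  case (Cons b as)
  then have ab: "a < b" "b \<le> n" "\<forall>x\<in>set as. b < x" by auto
  then have "{a..n} - set (a # b # as) = {a<..<b} \<union> ({b..n} - set (b # as))" by force
  moreover have "cover_sum (path_edges a n) (Backbone ` ({a<..<b} \<union> ({b..n} - set (b # as)))) =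
      cover_sum (path_edges a b) (Backbone ` {a<..<b}) *
      cover_sum (path_edges b n) (Backbone ` ({b..n} - set (b # as)))"
    by (rule cover_sum_path_edges_split) (use ab in auto)
  moreover have "cover_sum (path_edges a b) (Backbone ` {a<..<b}) = s3 (b - a + 2)"
    \<comment> \<open>The recurrence in \<open>s3_simps\<close> would expand the factor
      \<open>s3 (b - a + 2)\<close>, which is to stay intact.\<close>
    using cover_sum_path_left_covered[of a "b - a"] ab by (simp del: s3_simps)
  moreover have "cover_sum (path_edges b n) (Backbone ` ({b..n} - set (b # as))) =
      - (\<Prod>(x, y)\<leftarrow>zip (b # as) as. s3 (y - x + 2)) * s3 (n - last (b # as) + 1)"
    using Cons.prems by (intro Cons.IH) auto
  ultimately show ?case by (simp del: s3_simps)
qed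

lemma cover_sum_path_with_covered:
  assumes "sorted_wrt (<) as" "as \<noteq> []" "\<forall>x\<in>set as. k \<le> x \<and> x \<le> n"
  shows "cover_sum (path_edges k n) (Backbone ` ({k..n} - set as)) =
    s3 (hd as - k + 1) * (\<Prod>(x, y)\<leftarrow>zip as (tl as). s3 (y - x + 2)) * s3 (n - last as + 1)"
proof -
  obtain a as' where as: "as = a # as'" using assms by (cases as) auto
  then have a: "k \<le> a" "a \<le> n" "\<forall>x\<in>set as'. a < x" using assms by auto
  then have "{k..n} - set as = {k..<a} \<union> ({a..n} - set as)" by (force simp: as)
  moreover have "cover_sum (path_edges k n) (Backbone ` ({k..<a} \<union> ({a..n} - set as))) =
      cover_sum (path_edges k a) (Backbone ` {k..<a}) *
      cover_sum (path_edges a n) (Backbone ` ({a..n} - set as))"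
    by (rule cover_sum_path_edges_split) (use a as in auto)
  \<comment> \<open>This segment has a free left end and a covered right end; its minus sign cancels
    that of the last segment.\<close>
  moreover have "cover_sum (path_edges k a) (Backbone ` {k..<a}) = - s3 (a - k + 1)"
    using cover_sum_path[of k "a - k"] a by (simp del: s3_simps)
  ultimately show ?thesis
    using cover_sum_path_from_covered[of a as' n] assms by (simp add: as del: s3_simps)
qed

section \<open>Removal of the hanging edges\<close>

text \<open>\<open>Hanging d\<close> lies on one edge only. That edge is forced, contributes a
  factor -1 and covers \<open>d\<close>; since \<open>K\<close> shrinks in this way, the induction
  has to generalise over it.\<close>

lemma cover_sum_hanging_edges:
  assumes "finite D" "finite E" "\<Union>E \<subseteq> range Backbone"
  shows "cover_sum (E \<union> (\<lambda>v. {Backbone v, Hanging v}) ` D) (Backbone ` K \<union> Hanging ` D) =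
    (-1) ^ card D * cover_sum E (Backbone ` (K - D))"
  using assms(1)
proof (induction D arbitrary: K)
  case empty
  then show ?case by simp
next
  case (insert d D)
  let ?e = "{Backbone d, Hanging d}" and ?E = "E \<union> (\<lambda>v. {Backbone v, Hanging v}) ` D"
  have "cover_sum (insert ?e ?E) (Backbone ` K \<union> Hanging ` insert d D) =
      - cover_sum ?E (Backbone ` K \<union> Hanging ` insert d D - ?e)"
    by (rule cover_sum_insert_forced[of _ "Hanging d"]) (use insert.hyps assms(2,3) in auto)
  moreover have "Backbone ` K \<union> Hanging ` insert d D - ?e = Backbone ` (K - {d}) \<union> Hanging ` D"
    using insert.hyps by auto
  moreover have "K - {d} - D = K - insert d D" by auto
  ultimately show ?case using insert.hyps by (simp add: insert.IH)
qed

section \<open>Components of the partition graph\<close>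

text \<open>A height that changes by at most 1 along each edge, so that a walk cannot jump over a
  missing value.\<close>

fun vertex_value :: "vertex \<Rightarrow> nat" where
  "vertex_value (Backbone v) = v"
| "vertex_value (Hanging v) = v"

context
  fixes p :: "nat list"
begin

lemma mu2_subset_mu1: "mu2 p \<subseteq> mu1 p"
proof
  fix v assume "v \<in> mu2 p"
  then have "count_list p v \<noteq> 0" by (simp add: mu2_def)
  then show "v \<in> mu1 p" by (simp add: mu1_def count_list_0_iff)
qed

lemma finite_mu: "finite (mu1 p)" "finite (mu2 p)"
  using mu2_subset_mu1 finite_subset by (auto simp: mu1_def)

lemma partition_graph_edges:
  "snd (partition_graph p) = (\<lambda>v. {Backbone v, Backbone (Suc v)}) ` {v\<in>mu1 p. Suc v \<in> mu1 p} \<union>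
     (\<lambda>v. {Backbone v, Hanging v}) ` mu2 p"
  by (auto simp: partition_graph_def)

lemma partition_graph_vertices:
  "fst (partition_graph p) = Backbone ` mu1 p \<union> Hanging ` mu2 p"
  by (simp add: partition_graph_def)

text \<open>A hanging vertex belongs to the component of its backbone vertex. The backbone part has
  no gap, because a walk from its minimum to its maximum would have to visit the gap.\<close>

lemma component_structure:
  assumes c: "c \<in> connected_components (partition_graph p)"
  defines "B \<equiv> {v. Backbone v \<in> c}"
  shows "B \<noteq> {}" "B \<subseteq> mu1 p" "c = Backbone ` B \<union> Hanging ` (B \<inter> mu2 p)" "B = {Min B..Max B}"
proof -
  let ?G = "partition_graph p"
  have "c \<subseteq> fst ?G" using c Union_connected_components[of ?G] by blast
  have "c \<noteq> {}"
    using c in_quotient_imp_non_empty[OF equiv_adj_closure] unfolding connected_components_eq by blast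
  have closed: "y \<in> c" if "x \<in> c" "{x, y} \<in> snd ?G" "y \<in> fst ?G" for x y
    using connected_component_closed[OF c] that by blast
  have hang: "Hanging v \<in> c \<longleftrightarrow> Backbone v \<in> c \<and> v \<in> mu2 p" for v
  proof -
    have "{Backbone v, Hanging v} \<in> snd ?G" "Backbone v \<in> fst ?G" "Hanging v \<in> fst ?G"
      if "v \<in> mu2 p"
      using that mu2_subset_mu1 by (auto simp: partition_graph_edges partition_graph_vertices)
    then show ?thesis
      using closed[of "Backbone v" "Hanging v"] closed[of "Hanging v" "Backbone v"] \<open>c \<subseteq> fst ?G\<close>
      by (auto simp: insert_commute partition_graph_vertices)
  qed
  show sub: "B \<subseteq> mu1 p" using \<open>c \<subseteq> fst ?G\<close> by (auto simp: B_def partition_graph_vertices)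
  show cB: "c = Backbone ` B \<union> Hanging ` (B \<inter> mu2 p)"
  proof (intro set_eqI)
    fix x show "x \<in> c \<longleftrightarrow> x \<in> Backbone ` B \<union> Hanging ` (B \<inter> mu2 p)"
      by (cases x) (auto simp: B_def hang)
  qed
  show ne: "B \<noteq> {}" using \<open>c \<noteq> {}\<close> cB by auto
  have fin: "finite B" using sub finite_mu finite_subset by blast
  have "z \<in> B" if z: "Min B \<le> z" "z \<le> Max B" for z
  proof (rule ccontr)
    assume "z \<notin> B"
    have mem: "Min B \<in> B" "Max B \<in> B" using fin ne by auto
    then have "(Backbone (Min B), Backbone (Max B)) \<in> adj_closure ?G"
      using c quotient_eq_iff[OF equiv_adj_closure, of c ?G c] by (auto simp: connected_components_eq B_def)
    then have "(Backbone (Min B), Backbone (Max B)) \<in> {(x, y). {x, y} \<in> snd ?G}\<^sup>*"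
      by (simp add: adj_closure_def)
    \<comment> \<open>Invariant of the walk: it stays in \<open>c\<close> and below the supposed gap
      \<open>z\<close>. At its end this contradicts \<open>z \<le> Max B\<close>.\<close>
    then have "Backbone (Max B) \<in> c \<and> vertex_value (Backbone (Max B)) < z"
    proof (induction rule: rtrancl_induct)
      case base
      show ?case using mem z \<open>z \<notin> B\<close> by (auto simp: B_def order_less_le)
    next
      case (step x y)
      then have xy: "{x, y} \<in> snd ?G" by auto
      then have "y \<in> fst ?G" using mu2_subset_mu1
        by (auto simp: partition_graph_edges partition_graph_vertices doubleton_eq_iff)
      then have y: "y \<in> c" using closed step xy by blast
      have "vertex_value y \<in> B" using y cB by auto
      moreover have "vertex_value y \<le> Suc (vertex_value x)"
      proof -
        obtain v where "{x, y} = {Backbone v, Backbone (Suc v)} \<or> {x, y} = {Backbone v, Hanging v}"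
          using xy unfolding partition_graph_edges by blast
        then have "x = Backbone v \<and> y = Backbone (Suc v) \<or> x = Backbone (Suc v) \<and> y = Backbone v \<or>
            x = Backbone v \<and> y = Hanging v \<or> x = Hanging v \<and> y = Backbone v"
          by (simp only: doubleton_eq_iff) blast
        then show ?thesis by (elim disjE) simp_all
      qed
      ultimately have "vertex_value y \<noteq> z" "vertex_value y \<le> z"
        using step.IH \<open>z \<notin> B\<close> by auto
      then show ?case using y by simp
    qed
    then show False using z by simp
  qed
  then have "{Min B..Max B} \<subseteq> B" by (meson atLeastAtMost_iff subsetI)
  moreover have "B \<subseteq> {Min B..Max B}" using fin by (simp add: subset_iff)
  ultimately show "B = {Min B..Max B}" by (rule equalityI[rotated])
qed

text \<open>Stripping the hanging edges gives the sign and leaves the path on \<open>{k..n}\<close>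
  with the repeated values covered; its segments match the entries of
  \<open>SIG_component\<close>.\<close>

lemma cover_sum_component:
  assumes c: "c \<in> connected_components (partition_graph p)"
  shows "cover_sum {e \<in> snd (partition_graph p). e \<subseteq> c} c =
    (-1) ^ card ({v. Backbone v \<in> c} \<inter> mu2 p) * prod_mset (image_mset s3 (SIG_component p c))"
proof -
  define B where "B = {v. Backbone v \<in> c}"
  define k n where "k = Min B" and "n = Max B"
  define as where "as = sorted_list_of_set (B \<inter> mu2 p)"
  note cs = component_structure[OF c, folded B_def, folded k_def n_def]
  have kn: "k \<le> n" using cs(1,4) by force
  have Bf: "finite (B \<inter> mu2 p)" using finite_mu by simp
  have as: "set as = B \<inter> mu2 p" "sorted_wrt (<) as"
    using Bf by (auto simp: as_def)
  have "{e \<in> snd (partition_graph p). e \<subseteq> c} =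
      path_edges k n \<union> (\<lambda>v. {Backbone v, Hanging v}) ` (B \<inter> mu2 p)" (is "?L = _")
  proof -
    have b: "Backbone v \<in> c \<longleftrightarrow> k \<le> v \<and> v \<le> n" for v
    proof -
      have "Backbone v \<in> c \<longleftrightarrow> v \<in> B" by (simp add: B_def)
      also have "\<dots> \<longleftrightarrow> k \<le> v \<and> v \<le> n" by (subst cs(4)) simp
      finally show ?thesis .
    qed
    have h: "Hanging v \<in> c \<longleftrightarrow> v \<in> B \<inter> mu2 p" for v by (subst cs(3)) auto
    have B1: "v \<in> mu1 p" if "k \<le> v" "v \<le> n" for v using cs(2,4) that by auto
    have "?L = (\<lambda>v. {Backbone v, Backbone (Suc v)}) ` {v\<in>mu1 p. Suc v \<in> mu1 p \<and> k \<le> v \<and> Suc v \<le> n} \<union>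
       (\<lambda>v. {Backbone v, Hanging v}) ` (B \<inter> mu2 p)"
      unfolding partition_graph_edges using b h by (auto simp: B_def)
    also have "{v\<in>mu1 p. Suc v \<in> mu1 p \<and> k \<le> v \<and> Suc v \<le> n} = {k..<n}"
      using B1 by auto
    finally show ?thesis .
  qed
  moreover have "c = Backbone ` {k..n} \<union> Hanging ` (B \<inter> mu2 p)"
    using cs(3,4) by simp
  ultimately have "cover_sum {e \<in> snd (partition_graph p). e \<subseteq> c} c =
      (-1) ^ card (B \<inter> mu2 p) * cover_sum (path_edges k n) (Backbone ` ({k..n} - B \<inter> mu2 p))"
    using cover_sum_hanging_edges[OF Bf, of "path_edges k n" "{k..n}"] by auto
  moreover have "cover_sum (path_edges k n) (Backbone ` ({k..n} - B \<inter> mu2 p)) =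
      prod_mset (image_mset s3 (SIG_component p c))"
  proof (cases "as = []")
    case True
    then have "SIG_component p c = {#n - k#}"
      by (simp add: SIG_component_def Let_def flip: B_def k_def n_def as_def)
    then show ?thesis
      using cover_sum_path[of k "n - k"] kn True as by auto
  next
    case False
    then have "SIG_component p c = {#hd as - k + 1#}
        + mset (map (\<lambda>(a, b). b - a + 2) (zip as (tl as))) + {#n - last as + 1#}"
      by (simp add: SIG_component_def Let_def flip: B_def k_def n_def as_def)
    moreover have "cover_sum (path_edges k n) (Backbone ` ({k..n} - set as)) =
      s3 (hd as - k + 1) * (\<Prod>(x, y)\<leftarrow>zip as (tl as). s3 (y - x + 2)) * s3 (n - last as + 1)"
      by (rule cover_sum_path_with_covered) (use False as cs(4) in auto)
    ultimately show ?thesis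
      \<comment> \<open>Reversing \<open>mset_map\<close> moves \<open>s3\<close> into the list, so
        that the multiset product becomes the list product.\<close>
      by (simp add: as prod_mset_prod_list o_def case_prod_unfold del: s3_simps flip: mset_map)
  qed
  ultimately show ?thesis by (simp add: B_def)
qed

text \<open>Each repeated value lies in exactly one component, so the exponents of the component
  signs add up to \<open>card (mu2 p)\<close>.\<close>

lemma signature_partition_graph:
  "signature (partition_graph p) = (-1) ^ card (mu2 p) * prod_mset (image_mset s3 (SIG p))"
proof -
  let ?G = "partition_graph p"
  let ?C = "connected_components ?G"
  let ?D = "\<lambda>c. {v. Backbone v \<in> c} \<inter> mu2 p"
  note V = Union_connected_components[of ?G]
  have finV: "finite (fst ?G)" using finite_mu by (simp add: partition_graph_vertices)
  then have finC: "finite ?C"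
    unfolding connected_components_eq by (rule finite_quotient) (auto simp: adj_closure_def)
  have "signature ?G = (\<Prod>c\<in>?C. cover_sum {e \<in> snd ?G. e \<subseteq> c} c)"
  proof (rule signature_eq_prod_components[OF finV])
    show "finite (snd ?G)" using finite_mu by (simp add: partition_graph_edges)
    show "\<exists>x\<in>fst ?G. \<exists>y\<in>fst ?G. e = {x, y}" if "e \<in> snd ?G" for e
      using that mu2_subset_mu1 by (fastforce simp: partition_graph_edges partition_graph_vertices)
  qed
  also have "\<dots> = (\<Prod>c\<in>?C. (-1) ^ card (?D c) * prod_mset (image_mset s3 (SIG_component p c)))"
    by (rule prod.cong) (auto simp: cover_sum_component)
  also have "\<dots> = (-1) ^ (\<Sum>c\<in>?C. card (?D c)) * (\<Prod>c\<in>?C. prod_mset (image_mset s3 (SIG_component p c)))"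
    by (simp add: prod.distrib power_sum)
  also have "(\<Sum>c\<in>?C. card (?D c)) = card (\<Union>c\<in>?C. ?D c)"
  proof (rule card_UN_disjoint[symmetric, OF finC])
    show "\<forall>c\<in>?C. finite (?D c)" using finite_mu by simp
    show "\<forall>c\<in>?C. \<forall>d\<in>?C. c \<noteq> d \<longrightarrow> ?D c \<inter> ?D d = {}"
      using quotient_disj[OF equiv_adj_closure[of ?G]] unfolding connected_components_eq by blast
  qed
  also have "(\<Union>c\<in>?C. ?D c) = mu2 p"
  proof -
    have "\<exists>c\<in>?C. Backbone v \<in> c" if "v \<in> mu2 p" for v
    proof -
      have "Backbone v \<in> \<Union>?C"
        unfolding V using that mu2_subset_mu1 by (auto simp: partition_graph_vertices)
      then show ?thesis by blast
    qed
    then show ?thesis by auto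
  qed
  also have "(\<Prod>c\<in>?C. prod_mset (image_mset s3 (SIG_component p c))) = prod_mset (image_mset s3 (SIG p))"
    unfolding SIG_def using finC by (induction rule: finite_induct) auto
  finally show ?thesis .
qed

end

section \<open>Reading off zeros and signs\<close>

text \<open>A factor is 0 exactly at residue 0; among the others only residue 1 contributes
  -1.\<close>

lemma prod_mset_s3:
  "prod_mset (image_mset s3 X) =
    (if \<exists>x\<in>#X. x mod 3 = 0 then 0 else (-1) ^ size {#x \<in># X. x mod 3 = 1#})"
  by (induction X) (auto simp: s3_def)

theorem theorem2p16:
  fixes p :: "nat list"
  assumes "is_partition p" and "neighborly p"
  shows "(signature (partition_graph p) = 0 \<longleftrightarrow> (\<exists>x\<in>#SIG p. x mod 3 = 0)) \<and>
         (\<not> (\<exists>x\<in>#SIG p. x mod 3 = 0) \<longrightarrow>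
            signature (partition_graph p) =
              (-1) ^ (size {#x \<in># SIG p. x mod 3 = 1#} + card (mu2 p)))"
  \<comment> \<open>The sign from \<open>mu2 p\<close> is never 0, so the product over
    \<open>SIG p\<close> alone decides whether the signature vanishes.\<close>
  by (simp add: signature_partition_graph prod_mset_s3 power_add)

end
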